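(* Let $S_\ell$ be a fragment of $\lambda_{lin}^{=}$ and $S_a$ a fragment of $\lambda_{alg}^{=}$ such that for every $M\in S_\ell$, $(\widetilde M)~\lambda x\,x\in S_a$. For every term $M\in S_\ell$ and every value $V$: if $M \to^{=*}_{\ell\cup\beta} V$ (in the fragment $S_\ell$), then $(\widetilde M)~\lambda x\,x \to^{=*}_{a\cup\beta}\Psi(V)$ (in the fragment $S_a$).
   Context: Fix a ring of scalars (elements $\alpha,\beta$). Terms, values and base terms are given by: $M,N,L ::= V \mid (M)~N \mid \alpha.M \mid M+N$ (terms); $U,V,W ::= 0 \mid B \mid \alpha.V \mid V+W$ (values); $B ::= x \mid \lambda x\,M$ (base terms). Terms are taken up to renaming of bound variables; $M[x:=N]$ is capture-avoiding substitution. Below $V$ is a value and $B$ a base term. Rewrite rules: $(\beta_n)$ $(\lambda x\,M)~N\to M[x:=N]$. $(A)$ $(M+N)~L\to (M)~L+(N)~L$; $(\alpha.M)~N\to\alpha.(M)~N$; $(0)~M\to 0$. $(\beta_v)$ $(\lambda x\,M)~B\to M[x:=B]$. $(A_l)$ $(M+N)~V\to(M)~V+(N)~V$; $(\alpha.M)~V\to\alpha.(M)~V$; $(0)~V\to 0$. $(A_r)$ $(B)~(M+N)\to(B)~M+(B)~N$; $(B)~(\alpha.M)\to\alpha.(B)~M$; $(B)~0\to 0$. (Asso) $M+(N+L)\to(M+N)+L$ and $(M+N)+L\to M+(N+L)$. (Com) $M+N\to N+M$. $(F)$ $\alpha.M+\beta.M\to(\alpha+\beta).M$; $\alpha.M+M\to(\alpha+1).M$;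 $M+M\to(1+1).M$; $\alpha.(\beta.M)\to(\alpha\beta).M$. $(S)$ $\alpha.(M+N)\to\alpha.M+\alpha.N$; $1.M\to M$; $0.M\to 0$; $\alpha.0\to 0$; $0+M\to M$. Context rules $(\xi)$: from $M\to M'$ infer $(M)~N\to(M')~N$, $M+N\to M'+N$, $N+M\to N+M'$, $\alpha.M\to\alpha.M'$. Context rule $(\xi_{lin})$: from $M\to M'$ infer $(V)~M\to(V)~M'$ for $V$ a value. Let $L=\mathrm{Asso}\cup\mathrm{Com}\cup F\cup S$. Define: $\to_a$ generated by $A\cup L$ closed under $\xi$; $\to_\ell$ generated by $A_l\cup A_r\cup L$ closed under $\xi,\xi_{lin}$; $\to_{\beta_v}$ generated by $\beta_v$ closed under $\xi,\xi_{lin}$; $\to_{\beta_n}$ generated by $\beta_n$ closed under $\xi$. For a relation $R$, $R^{=}$ is its symmetric closure and $R^{*}$ its reflexive-transitive closure. Set $\to_{\ell\cup\beta}:=\to_\ell\cup\to_{\beta_v}$ (language $\lambda_{lin}^{\to}$), $\to_{a\cup\beta}:=\to_a\cup\to_{\beta_n}$ (language $\lambda_{alg}^{\to}$). Fragments: a fragment of $\lambda_{lin}^{\to}$ (resp. $\lambda_{alg}^{\to}$) is a set $S$ of terms closed under $\to_{\ell\cup\beta}$ (resp. $\to_{a\cup\beta}$), with the rewrite relation restricted to $S$. A fragment of $\lambda_{lin}^{=}$ (resp. $\lambda_{alg}^{=}$) is a fragment $S$ of $\lambda_{lin}^{\to}$ (resp. $\lambda_{alg}^{\to}$) equipped with the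 restricted algebraic equality: $M\to^{=}_\ell N$ holds in $S$ iff $M,N\in S$ and ($M\to_\ell N$ or $N\to_\ell M$) (resp. the same with $\to_a$); its reduction $\to^{=}_{\ell\cup\beta}$ (resp. $\to^{=}_{a\cup\beta}$) is this restricted equality union $\to_{\beta_v}$ (resp. $\to_{\beta_n}$), the $\beta$-reduction being unchanged. Translation (with $f,g,h$ fresh variables): $\widetilde{x}=\lambda f\,(f)~x$; $\widetilde{0}=0$; $\widetilde{\lambda x\,M}=\lambda f\,(f)~\lambda x\,\widetilde{M}$; $\widetilde{(M)~N}=\lambda f\,(\widetilde M)~\lambda g\,(\widetilde N)~\lambda h\,((g)~h)~f$; $\widetilde{\alpha.M}=\lambda f\,(\alpha.\widetilde M)~f$; $\widetilde{M+N}=\lambda f\,(\widetilde M+\widetilde N)~f$. On values: $\Psi(x)=x$, $\Psi(0)=0$, $\Psi(\lambda x\,M)=\lambda x\,\widetilde M$, $\Psi(\alpha.V)=\alpha.\Psi(V)$, $\Psi(V+W)=\Psi(V)+\Psi(W)$. *)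

theory Defs
  imports Main
begin

text \<open>
  Terms modulo renaming of bound variables are represented by de Bruijn indices; a free variable
  under \<open>n\<close> abstractions is an index \<open>\<ge> n\<close>.
  The scalars are an arbitrary unital ring. The sort is \<open>{ring, monoid_mult}\<close> rather than
  \<open>ring_1\<close>, because the latter additionally imposes \<open>0 \<noteq> 1\<close>.
\<close>

datatype 'a trm =
    Var nat
  | Lam "'a trm"
  | App "'a trm" "'a trm"
  | Zero
  | Scale 'a "'a trm"
  | Plus "'a trm" "'a trm"

fun is_base :: "'a trm \<Rightarrow> bool" where
  "is_base (Var n) = True"
| "is_base (Lam M) = True"
| "is_base (App M N) = False"
| "is_base Zero = False"
| "is_base (Scale \<alpha> M) = False"
| "is_base (Plus M N) = False"

fun is_value :: "'a trm \<Rightarrow> bool" where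
  "is_value (Var n) = True"
| "is_value (Lam M) = True"
| "is_value (App M N) = False"
| "is_value Zero = True"
| "is_value (Scale \<alpha> V) = is_value V"
| "is_value (Plus V W) = (is_value V \<and> is_value W)"

text \<open>\<open>lift M k\<close> renumbers the variables of \<open>M\<close> to make room for a new variable with index \<open>k\<close>.\<close>

primrec lift :: "'a trm \<Rightarrow> nat \<Rightarrow> 'a trm" where
  "lift (Var n) k = (if n < k then Var n else Var (Suc n))"
| "lift (Lam M) k = Lam (lift M (Suc k))"
| "lift (App M N) k = App (lift M k) (lift N k)"
| "lift Zero k = Zero"
| "lift (Scale \<alpha> M) k = Scale \<alpha> (lift M k)"
| "lift (Plus M N) k = Plus (lift M k) (lift N k)"

text \<open>
  \<open>subst M N k\<close> replaces the variable \<open>k\<close> of \<open>M\<close> by \<open>N\<close> and removes its binder, that is, it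
  decrements the indices above \<open>k\<close>. In particular \<open>subst M N 0\<close> is the contractum of
  \<open>App (Lam M) N\<close>.
\<close>

primrec subst :: "'a trm \<Rightarrow> 'a trm \<Rightarrow> nat \<Rightarrow> 'a trm" where
  "subst (Var n) N k = (if n < k then Var n else if n = k then N else Var (n - 1))"
| "subst (Lam M) N k = Lam (subst M (lift N 0) (Suc k))"
| "subst (App M1 M2) N k = App (subst M1 N k) (subst M2 N k)"
| "subst Zero N k = Zero"
| "subst (Scale \<alpha> M) N k = Scale \<alpha> (subst M N k)"
| "subst (Plus M1 M2) N k = Plus (subst M1 N k) (subst M2 N k)"

inductive rule_beta_n :: "'a trm \<Rightarrow> 'a trm \<Rightarrow> bool" where
  "rule_beta_n (App (Lam M) N) (subst M N 0)"

inductive rule_beta_v :: "'a trm \<Rightarrow> 'a trm \<Rightarrow> bool" where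
  "is_base B \<Longrightarrow> rule_beta_v (App (Lam M) B) (subst M B 0)"

inductive rule_A :: "'a trm \<Rightarrow> 'a trm \<Rightarrow> bool" where
  "rule_A (App (Plus M N) L) (Plus (App M L) (App N L))"
| "rule_A (App (Scale \<alpha> M) N) (Scale \<alpha> (App M N))"
| "rule_A (App Zero M) Zero"

inductive rule_Al :: "'a trm \<Rightarrow> 'a trm \<Rightarrow> bool" where
  "is_value V \<Longrightarrow> rule_Al (App (Plus M N) V) (Plus (App M V) (App N V))"
| "is_value V \<Longrightarrow> rule_Al (App (Scale \<alpha> M) V) (Scale \<alpha> (App M V))"
| "is_value V \<Longrightarrow> rule_Al (App Zero V) Zero"

inductive rule_Ar :: "'a trm \<Rightarrow> 'a trm \<Rightarrow> bool" where
  "is_base B \<Longrightarrow> rule_Ar (App B (Plus M N)) (Plus (App B M) (App B N))"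
| "is_base B \<Longrightarrow> rule_Ar (App B (Scale \<alpha> M)) (Scale \<alpha> (App B M))"
| "is_base B \<Longrightarrow> rule_Ar (App B Zero) Zero"

inductive rule_Asso :: "'a trm \<Rightarrow> 'a trm \<Rightarrow> bool" where
  "rule_Asso (Plus M (Plus N L)) (Plus (Plus M N) L)"
| "rule_Asso (Plus (Plus M N) L) (Plus M (Plus N L))"

inductive rule_Com :: "'a trm \<Rightarrow> 'a trm \<Rightarrow> bool" where
  "rule_Com (Plus M N) (Plus N M)"

inductive rule_F :: "'a::{ring, monoid_mult} trm \<Rightarrow> 'a trm \<Rightarrow> bool" where
  "rule_F (Plus (Scale \<alpha> M) (Scale \<beta> M)) (Scale (\<alpha> + \<beta>) M)"
| "rule_F (Plus (Scale \<alpha> M) M) (Scale (\<alpha> + 1) M)"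
| "rule_F (Plus M M) (Scale (1 + 1) M)"
| "rule_F (Scale \<alpha> (Scale \<beta> M)) (Scale (\<alpha> * \<beta>) M)"

inductive rule_S :: "'a::{ring, monoid_mult} trm \<Rightarrow> 'a trm \<Rightarrow> bool" where
  "rule_S (Scale \<alpha> (Plus M N)) (Plus (Scale \<alpha> M) (Scale \<alpha> N))"
| "rule_S (Scale 1 M) M"
| "rule_S (Scale 0 M) Zero"
| "rule_S (Scale \<alpha> Zero) Zero"
| "rule_S (Plus Zero M) M"

definition rule_L :: "'a::{ring, monoid_mult} trm \<Rightarrow> 'a trm \<Rightarrow> bool" where
  "rule_L = sup (sup rule_Asso rule_Com) (sup rule_F rule_S)"

inductive xi :: "('a trm \<Rightarrow> 'a trm \<Rightarrow> bool) \<Rightarrow> 'a trm \<Rightarrow> 'a trm \<Rightarrow> bool"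
  for R :: "'a trm \<Rightarrow> 'a trm \<Rightarrow> bool" where
  xi_rule: "R M M' \<Longrightarrow> xi R M M'"
| xi_app: "xi R M M' \<Longrightarrow> xi R (App M N) (App M' N)"
| xi_plus_left: "xi R M M' \<Longrightarrow> xi R (Plus M N) (Plus M' N)"
| xi_plus_right: "xi R M M' \<Longrightarrow> xi R (Plus N M) (Plus N M')"
| xi_scale: "xi R M M' \<Longrightarrow> xi R (Scale \<alpha> M) (Scale \<alpha> M')"

inductive xi_lin :: "('a trm \<Rightarrow> 'a trm \<Rightarrow> bool) \<Rightarrow> 'a trm \<Rightarrow> 'a trm \<Rightarrow> bool"
  for R :: "'a trm \<Rightarrow> 'a trm \<Rightarrow> bool" where
  xi_lin_rule: "R M M' \<Longrightarrow> xi_lin R M M'"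
| xi_lin_app_left: "xi_lin R M M' \<Longrightarrow> xi_lin R (App M N) (App M' N)"
| xi_lin_plus_left: "xi_lin R M M' \<Longrightarrow> xi_lin R (Plus M N) (Plus M' N)"
| xi_lin_plus_right: "xi_lin R M M' \<Longrightarrow> xi_lin R (Plus N M) (Plus N M')"
| xi_lin_scale: "xi_lin R M M' \<Longrightarrow> xi_lin R (Scale \<alpha> M) (Scale \<alpha> M')"
| xi_lin_app_right: "is_value V \<Longrightarrow> xi_lin R M M' \<Longrightarrow> xi_lin R (App V M) (App V M')"

definition red_a :: "'a::{ring, monoid_mult} trm \<Rightarrow> 'a trm \<Rightarrow> bool" where
  "red_a = xi (sup rule_A rule_L)"

definition red_l :: "'a::{ring, monoid_mult} trm \<Rightarrow> 'a trm \<Rightarrow> bool" where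
  "red_l = xi_lin (sup (sup rule_Al rule_Ar) rule_L)"

definition red_beta_n :: "'a trm \<Rightarrow> 'a trm \<Rightarrow> bool" where
  "red_beta_n = xi rule_beta_n"

definition red_beta_v :: "'a trm \<Rightarrow> 'a trm \<Rightarrow> bool" where
  "red_beta_v = xi_lin rule_beta_v"

definition red_l_beta :: "'a::{ring, monoid_mult} trm \<Rightarrow> 'a trm \<Rightarrow> bool" where
  "red_l_beta = sup red_l red_beta_v"

definition red_a_beta :: "'a::{ring, monoid_mult} trm \<Rightarrow> 'a trm \<Rightarrow> bool" where
  "red_a_beta = sup red_a red_beta_n"

definition closed_under :: "('a trm \<Rightarrow> 'a trm \<Rightarrow> bool) \<Rightarrow> 'a trm set \<Rightarrow> bool" where
  "closed_under R S \<longleftrightarrow> (\<forall>M N. M \<in> S \<longrightarrow> R M N \<longrightarrow> N \<in> S)"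

definition restrict_to :: "'a trm set \<Rightarrow> ('a trm \<Rightarrow> 'a trm \<Rightarrow> bool) \<Rightarrow> 'a trm \<Rightarrow> 'a trm \<Rightarrow> bool" where
  "restrict_to S R M N \<longleftrightarrow> M \<in> S \<and> N \<in> S \<and> R M N"

text \<open>
  The fragments of the systems with algebraic equalities have the same carriers as those of the
  systems with algebraic reductions, so closure is required for the oriented reductions only.
\<close>

definition lin_fragment :: "'a::{ring, monoid_mult} trm set \<Rightarrow> bool" where
  "lin_fragment S \<longleftrightarrow> closed_under red_l_beta S"

definition alg_fragment :: "'a::{ring, monoid_mult} trm set \<Rightarrow> bool" where
  "alg_fragment S \<longleftrightarrow> closed_under red_a_beta S"

definition lin_eq_red :: "'a::{ring, monoid_mult} trm set \<Rightarrow> 'a trm \<Rightarrow> 'a trm \<Rightarrow> bool" where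
  "lin_eq_red S = sup (restrict_to S (symclp red_l)) (restrict_to S red_beta_v)"

definition alg_eq_red :: "'a::{ring, monoid_mult} trm set \<Rightarrow> 'a trm \<Rightarrow> 'a trm \<Rightarrow> bool" where
  "alg_eq_red S = sup (restrict_to S (symclp red_a)) (restrict_to S red_beta_n)"

text \<open>
  Lifting at \<open>0\<close> expresses that the binders \<open>f\<close>, \<open>g\<close>, \<open>h\<close> introduced by the translation are fresh.
  In the body of the application case, \<open>f\<close>, \<open>g\<close>, \<open>h\<close> are the indices \<open>2\<close>, \<open>1\<close>, \<open>0\<close>.
\<close>

primrec tr :: "'a trm \<Rightarrow> 'a trm" where
  "tr (Var n) = Lam (App (Var 0) (lift (Var n) 0))"
| "tr Zero = Zero"
| "tr (Lam M) = Lam (App (Var 0) (lift (Lam (tr M)) 0))"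
| "tr (App M N) =
     Lam (App (lift (tr M) 0)
       (Lam (App (lift (lift (tr N) 0) 0)
         (Lam (App (App (Var 1) (Var 0)) (Var 2))))))"
| "tr (Scale \<alpha> M) = Lam (App (lift (Scale \<alpha> (tr M)) 0) (Var 0))"
| "tr (Plus M N) = Lam (App (lift (Plus (tr M) (tr N)) 0) (Var 0))"

text \<open>\<open>Psi\<close> is meaningful on values only, hence unspecified on applications.\<close>

fun Psi :: "'a trm \<Rightarrow> 'a trm" where
  "Psi (Var n) = Var n"
| "Psi Zero = Zero"
| "Psi (Lam M) = Lam (tr M)"
| "Psi (Scale \<alpha> V) = Scale \<alpha> (Psi V)"
| "Psi (Plus V W) = Plus (Psi V) (Psi W)"
| "Psi (App M N) = undefined"

end

(* A colon translation that performs all administrative reductions, under the applications as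
   well, is linear in the source term. The rules A_l and A_r then become identities and the rules
   of L become algebraic steps, so that no beta-step is ever needed to simulate an algebraic step.
   Algebraic steps can therefore be simulated backwards too, and all intermediate terms stay in
   the target fragment because they are reachable from the translation of the source of the step. *)

theory Submission
  imports Defs
begin

lemma lift_lift: "i \<le> k \<Longrightarrow> lift (lift M i) (Suc k) = lift (lift M k) i"
  by (induction M arbitrary: i k) auto

lemma subst_lift: "subst (lift M k) N k = M"
  by (induction M arbitrary: N k) auto

lemma lift_subst: "i \<le> k \<Longrightarrow> lift (subst M N k) i = subst (lift M i) (lift N i) (Suc k)"
  by (induction M arbitrary: N i k) (auto simp: lift_lift)

lemma tr_lift: "tr (lift M k) = lift (tr M) k"
  by (induction M arbitrary: k) (auto simp: lift_lift)

lemma Psi_lift: "is_base B \<Longrightarrow> Psi (lift B k) = lift (Psi B) k"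
  by (cases B) (auto simp: tr_lift)

lemma is_base_lift: "is_base B \<Longrightarrow> is_base (lift B k)"
  by (cases B) auto

lemma tr_base: "is_base B \<Longrightarrow> tr B = Lam (App (Var 0) (lift (Psi B) 0))"
  by (cases B) auto

text \<open>Up to lifting, \<open>tr (Var k)\<close> and \<open>tr B\<close> are the same
  abstraction around \<open>Var k\<close> and around \<open>Psi B\<close>. Putting
  \<open>Psi B\<close> for the variable thus turns the one into the other.\<close>

lemma tr_subst: "is_base B \<Longrightarrow> tr (subst M B k) = subst (tr M) (Psi B) k"
  by (induction M arbitrary: B k) (auto simp: lift_lift lift_subst tr_base Psi_lift is_base_lift)

text \<open>This is the continuation that \<open>tr (App M N)\<close> hands to \<open>tr M\<close>
  after receiving \<open>K\<close>. Once \<open>M\<close> has delivered a base term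
  \<open>B\<close>, the continuation handed to \<open>tr N\<close> is
  \<open>karg B K\<close>.\<close>

definition kfun :: "'a trm \<Rightarrow> 'a trm \<Rightarrow> 'a trm" where
  "kfun N K = Lam (App (lift (tr N) 0)
     (Lam (App (App (Var 1) (Var 0)) (lift (lift K 0) 0))))"

definition karg :: "'a trm \<Rightarrow> 'a trm \<Rightarrow> 'a trm" where
  "karg B K = Lam (App (App (lift (Psi B) 0) (Var 0)) (lift K 0))"

text \<open>\<open>k B\<close> stands for the result of the administrative reduction of \<open>App K (Psi B)\<close>.\<close>

primrec colon :: "'a trm \<Rightarrow> 'a trm \<Rightarrow> ('a trm \<Rightarrow> 'a trm) \<Rightarrow> 'a trm" where
  "colon (Var n) K k = k (Var n)"
| "colon (Lam M) K k = k (Lam M)"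
| "colon (App M N) K k = colon M (kfun N K)
     (\<lambda>B. colon N (karg B K) (\<lambda>C. App (App (Psi B) (Psi C)) K))"
| "colon Zero K k = Zero"
| "colon (Scale \<alpha> M) K k = Scale \<alpha> (colon M K k)"
| "colon (Plus M N) K k = Plus (colon M K k) (colon N K k)"

lemma colon_base: "is_base B \<Longrightarrow> colon B K k = k B"
  by (cases B) auto

lemma colon_value: "is_value V \<Longrightarrow> colon V K Psi = Psi V"
  by (induction V) auto

lemma xi_mono: "xi R M N \<Longrightarrow> R \<le> R' \<Longrightarrow> xi R' M N"
  by (induction rule: xi.induct) (auto intro: xi.intros)

lemma xi_supD: "xi (sup R R') M N \<Longrightarrow> xi R M N \<or> xi R' M N"
  by (induction rule: xi.induct) (auto intro: xi.intros)

text \<open>Each context rule has a single premise, so context closure commutes with union.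
  Reductions that mix algebraic and beta steps can then be lifted through sums and scalars.\<close>

lemma red_a_beta_eq_xi: "red_a_beta = xi (sup (sup rule_A rule_L) rule_beta_n)"
  by (intro ext)
    (auto simp: red_a_beta_def red_a_def red_beta_n_def intro: xi_mono dest: xi_supD)

lemma rtranclp_xi_plus:
  assumes "(xi R)\<^sup>*\<^sup>* M M'" "(xi R)\<^sup>*\<^sup>* N N'"
  shows "(xi R)\<^sup>*\<^sup>* (Plus M N) (Plus M' N')"
proof -
  have "(xi R)\<^sup>*\<^sup>* (Plus M N) (Plus M' N)"
    using assms(1) by induction (auto intro: rtranclp.rtrancl_into_rtrancl xi_plus_left)
  also have "(xi R)\<^sup>*\<^sup>* (Plus M' N) (Plus M' N')"
    using assms(2) by induction (auto intro: rtranclp.rtrancl_into_rtrancl xi_plus_right)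
  finally show ?thesis .
qed

lemma rtranclp_xi_scale: "(xi R)\<^sup>*\<^sup>* M M' \<Longrightarrow> (xi R)\<^sup>*\<^sup>* (Scale \<alpha> M) (Scale \<alpha> M')"
  by (induction rule: rtranclp_induct) (auto intro: rtranclp.rtrancl_into_rtrancl xi_scale)

text \<open>Outside abstractions a value has no application, so \<open>colon\<close> only calls
  \<open>k\<close> at base terms and never uses its second argument. Hence \<open>K\<close> and
  \<open>K'\<close> may be unrelated.\<close>

lemma colon_value_cong:
  assumes "is_value V" and "\<And>B. is_base B \<Longrightarrow> (xi R)\<^sup>*\<^sup>* (k B) (k' B)"
  shows "(xi R)\<^sup>*\<^sup>* (colon V K k) (colon V K' k')"
  using assms by (induction V) (auto intro: rtranclp_xi_plus rtranclp_xi_scale)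

lemma red_a_beta_beta: "red_a_beta (App (Lam M) N) (subst M N 0)"
  by (auto simp: red_a_beta_eq_xi intro: xi_rule rule_beta_n.intros)

lemma red_a_beta_A: "rule_A M N \<Longrightarrow> red_a_beta M N"
  by (auto simp: red_a_beta_eq_xi intro: xi_rule)

lemma red_a_beta_app: "red_a_beta M M' \<Longrightarrow> red_a_beta (App M N) (App M' N)"
  by (auto simp: red_a_beta_eq_xi intro: xi_app)

lemma beta_kfun: "red_a_beta (App (kfun N K) (Psi B)) (App (tr N) (karg B K))"
  using red_a_beta_beta[of "App (lift (tr N) 0)
     (Lam (App (App (Var 1) (Var 0)) (lift (lift K 0) 0)))" "Psi B"]
  by (simp add: kfun_def karg_def subst_lift lift_subst[symmetric])

lemma beta_karg: "red_a_beta (App (karg B K) C) (App (App (Psi B) C) K)"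
  using red_a_beta_beta[of "App (App (lift (Psi B) 0) (Var 0)) (lift K 0)" C]
  by (simp add: karg_def subst_lift)

lemma red_tr_colon:
  fixes M :: "'a::{ring, monoid_mult} trm"
  assumes "\<And>B. is_base B \<Longrightarrow> red_a_beta\<^sup>*\<^sup>* (App K (Psi B)) (k B)"
  shows "red_a_beta\<^sup>*\<^sup>* (App (tr M) K) (colon M K k)"
  using assms
proof (induction M arbitrary: K k)
  case (Var n)
  have "red_a_beta (App (tr (Var n)) K) (App K (Psi (Var n)))"
    using red_a_beta_beta[of "App (Var 0) (lift (Var n) 0)" K] by simp
  with Var[of "Var n"] show ?case by (auto intro: converse_rtranclp_into_rtranclp)
next
  case (Lam M)
  have "red_a_beta (App (tr (Lam M)) K) (App K (Psi (Lam M)))"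
    using red_a_beta_beta[of "App (Var 0) (lift (Lam (tr M)) 0)" K]
    by (simp add: subst_lift)
  with Lam.prems[of "Lam M"] show ?case
    by (auto intro: converse_rtranclp_into_rtranclp)
next
  case (App M N)
  have "red_a_beta (App (tr (App M N)) K) (App (tr M) (kfun N K))"
    using red_a_beta_beta[of "App (lift (tr M) 0)
       (Lam (App (lift (lift (tr N) 0) 0)
         (Lam (App (App (Var 1) (Var 0)) (Var 2)))))" K]
    by (simp add: kfun_def subst_lift lift_subst[symmetric])
  moreover have "red_a_beta\<^sup>*\<^sup>* (App (tr M) (kfun N K)) (colon (App M N) K k)"
    unfolding colon.simps
    \<comment> \<open>The premise for \<open>kfun N K\<close> is met by one beta step followed by
      the induction hypothesis for \<open>N\<close>, whose own premise for \<open>karg B K\<close>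
      is met by a single beta step.\<close>
    by (intro App.IH(1) converse_rtranclp_into_rtranclp[of red_a_beta, OF beta_kfun]
        App.IH(2) r_into_rtranclp[of red_a_beta, OF beta_karg])
  ultimately show ?case by (auto intro: converse_rtranclp_into_rtranclp)
next
  case Zero
  show ?case by (auto intro: red_a_beta_A rule_A.intros)
next
  case (Scale \<alpha> M)
  have "red_a_beta\<^sup>*\<^sup>* (App (tr (Scale \<alpha> M)) K) (App (Scale \<alpha> (tr M)) K)"
    using red_a_beta_beta[of "App (lift (Scale \<alpha> (tr M)) 0) (Var 0)" K]
    by (simp add: subst_lift r_into_rtranclp)
  also have "red_a_beta\<^sup>*\<^sup>* \<dots> (Scale \<alpha> (App (tr M) K))"
    by (intro r_into_rtranclp red_a_beta_A rule_A.intros)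
  also have "red_a_beta\<^sup>*\<^sup>* \<dots> (colon (Scale \<alpha> M) K k)"
    using Scale.IH[OF Scale.prems] by (auto simp: red_a_beta_eq_xi intro: rtranclp_xi_scale)
  finally show ?case .
next
  case (Plus M N)
  have "red_a_beta\<^sup>*\<^sup>* (App (tr (Plus M N)) K) (App (Plus (tr M) (tr N)) K)"
    using red_a_beta_beta[of "App (lift (Plus (tr M) (tr N)) 0) (Var 0)" K]
    by (simp add: subst_lift r_into_rtranclp)
  also have "red_a_beta\<^sup>*\<^sup>* \<dots> (Plus (App (tr M) K) (App (tr N) K))"
    by (intro r_into_rtranclp red_a_beta_A rule_A.intros)
  also have "red_a_beta\<^sup>*\<^sup>* \<dots> (colon (Plus M N) K k)"
    using Plus.IH(1)[OF Plus.prems] Plus.IH(2)[OF Plus.prems]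
    by (auto simp: red_a_beta_eq_xi intro: rtranclp_xi_plus)
  finally show ?case .
qed

text \<open>\<open>colon\<close> commutes with sums, scalars and zero while \<open>K\<close> and
  \<open>k\<close> stay fixed, so every instance is mapped to a root instance of the same
  rule.\<close>

lemma rule_L_colon:
  assumes "rule_L M M'"
  shows "rule_L (colon M K k) (colon M' K k)"
  using assms unfolding rule_L_def
  by (auto elim!: rule_Asso.cases rule_Com.cases rule_F.cases rule_S.cases
      intro: rule_Asso.intros rule_Com.intros rule_F.intros rule_S.intros)

lemma rule_Al_colon: "rule_Al M M' \<Longrightarrow> colon M K k = colon M' K k"
  by (auto elim!: rule_Al.cases)

text \<open>A base term in function position calls its \<open>k\<close> at once, which leaves
  \<open>colon\<close> to distribute over the argument.\<close>

lemma rule_Ar_colon: "rule_Ar M M' \<Longrightarrow> colon M K k = colon M' K k"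
  by (auto elim!: rule_Ar.cases simp: colon_base)

text \<open>No link between \<open>K\<close> and \<open>k\<close> is assumed and no beta step
  occurs, which is what makes the simulation reversible. For a step in the argument of a value,
  \<open>kfun M K\<close> and \<open>kfun M' K\<close> differ under an abstraction, where nothing
  reduces, but the value discards them.\<close>

lemma red_l_colon:
  assumes "red_l M M'"
  shows "red_a\<^sup>*\<^sup>* (colon M K k) (colon M' K k)"
  using assms unfolding red_l_def red_a_def
proof (induction arbitrary: K k rule: xi_lin.induct)
  case (xi_lin_rule M M')
  then consider "colon M K k = colon M' K k" | "rule_L M M'"
    using rule_Al_colon rule_Ar_colon by fastforce
  then show ?case
  proof cases
    case 2
    then show ?thesis by (auto intro: xi_rule rule_L_colon)
  qed simp
qed (auto intro: rtranclp_xi_plus rtranclp_xi_scale colon_value_cong)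

lemma red_beta_v_colon:
  fixes M :: "'a::{ring, monoid_mult} trm"
  assumes "red_beta_v M M'"
    and "\<And>B. is_base B \<Longrightarrow> red_a_beta\<^sup>*\<^sup>* (App K (Psi B)) (k B)"
  shows "red_a_beta\<^sup>*\<^sup>* (colon M K k) (colon M' K k)"
  using assms unfolding red_beta_v_def
proof (induction arbitrary: K k rule: xi_lin.induct)
  case (xi_lin_rule M M')
  from xi_lin_rule(1) obtain N B where MN: "M = App (Lam N) B" "M' = subst N B 0" and "is_base B"
    by (auto elim: rule_beta_v.cases)
  \<comment> \<open>The redex becomes \<open>App (App (Lam (tr N)) (Psi B)) K\<close>, and its head
    contracts to \<open>tr M'\<close>. The link between \<open>K\<close> and \<open>k\<close> is
    then needed to pass from \<open>App (tr M') K\<close> to \<open>colon M' K k\<close>.\<close>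
  then have "red_a_beta (colon M K k) (App (tr M') K)"
    using red_a_beta_app[OF red_a_beta_beta[of "tr N" "Psi B"]] by (simp add: colon_base tr_subst)
  then show ?case
    using red_tr_colon[OF xi_lin_rule(2)] by (auto intro: converse_rtranclp_into_rtranclp)
next
  case (xi_lin_app_left M M' N)
  show ?case unfolding colon.simps
    by (intro xi_lin_app_left.IH converse_rtranclp_into_rtranclp[of red_a_beta, OF beta_kfun]
        red_tr_colon r_into_rtranclp[of red_a_beta, OF beta_karg])
next
  case (xi_lin_app_right V M M')
  show ?case unfolding colon.simps red_a_beta_eq_xi
    by (intro colon_value_cong xi_lin_app_right.hyps
        xi_lin_app_right.IH[unfolded red_a_beta_eq_xi]
        r_into_rtranclp[of "xi _", OF beta_karg[unfolded red_a_beta_eq_xi]])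
qed (auto simp: red_a_beta_eq_xi intro!: rtranclp_xi_plus rtranclp_xi_scale)

lemma alg_fragment_rtranclp:
  assumes "alg_fragment S" "M \<in> S" "red_a_beta\<^sup>*\<^sup>* M N"
  shows "N \<in> S \<and> (alg_eq_red S)\<^sup>*\<^sup>* M N"
  using assms(3)
proof induction
  case (step N N')
  then have "N' \<in> S"
    using assms(1) by (auto simp: alg_fragment_def closed_under_def)
  with step have "alg_eq_red S N N'"
    by (auto simp: alg_eq_red_def restrict_to_def red_a_beta_def symclp_def)
  with step \<open>N' \<in> S\<close> show ?case by auto
qed (use assms in simp)

lemma rtranclp_red_a_imp_red_a_beta: "red_a\<^sup>*\<^sup>* M N \<Longrightarrow> red_a_beta\<^sup>*\<^sup>* M N"
  by (erule rtranclp_mono[THEN predicate2D, rotated]) (auto simp: red_a_beta_def)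

lemma alg_fragment_rtranclp_rev:
  assumes "alg_fragment S" "M \<in> S" "red_a\<^sup>*\<^sup>* M N"
  shows "(alg_eq_red S)\<^sup>*\<^sup>* N M"
  using assms(3)
proof induction
  case (step N N')
  \<comment> \<open>\<open>S\<close> need not be closed under inverse steps, but both terms are
    reachable forwards from \<open>M\<close>.\<close>
  have "N \<in> S" "N' \<in> S"
    using step(1) rtranclp.rtrancl_into_rtrancl[OF step(1,2)]
      alg_fragment_rtranclp[OF assms(1,2)] rtranclp_red_a_imp_red_a_beta by blast+
  with step(2) have "alg_eq_red S N' N"
    by (auto simp: alg_eq_red_def restrict_to_def symclp_def)
  with step(3) show ?case by (auto intro: converse_rtranclp_into_rtranclp)
qed simp

theorem theorem7:
  fixes S\<^sub>l S\<^sub>a :: "'a::{ring, monoid_mult} trm set"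
    and M V :: "'a trm"
  assumes "lin_fragment S\<^sub>l"
    and "alg_fragment S\<^sub>a"
    and "\<forall>N \<in> S\<^sub>l. App (tr N) (Lam (Var 0)) \<in> S\<^sub>a"
    and "M \<in> S\<^sub>l"
    and "is_value V"
    and "(lin_eq_red S\<^sub>l)\<^sup>*\<^sup>* M V"
  shows "(alg_eq_red S\<^sub>a)\<^sup>*\<^sup>* (App (tr M) (Lam (Var 0))) (Psi V)"
proof -
  let ?I = "Lam (Var 0) :: 'a trm"
  let ?c = "\<lambda>N. colon N ?I Psi"
  have id: "red_a_beta\<^sup>*\<^sup>* (App ?I (Psi B)) (Psi B)" for B
    using red_a_beta_beta[of "Var 0" "Psi B"] by auto
  \<comment> \<open>Membership of \<open>?c N\<close> in the target fragment comes from
    reachability, so it holds for every term of the source fragment, in particular for both ends of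
    each step.\<close>
  have admin: "?c N \<in> S\<^sub>a \<and> (alg_eq_red S\<^sub>a)\<^sup>*\<^sup>* (App (tr N) ?I) (?c N)" if "N \<in> S\<^sub>l" for N
    using alg_fragment_rtranclp[OF assms(2)] red_tr_colon[OF id] assms(3) that by blast
  have "(alg_eq_red S\<^sub>a)\<^sup>*\<^sup>* (App (tr M) ?I) (?c V)"
    using assms(6)
  proof induction
    case base
    show ?case using admin assms(4) by blast
  next
    case (step N N')
    then have in_S: "?c N \<in> S\<^sub>a" "?c N' \<in> S\<^sub>a"
      using admin by (auto simp: lin_eq_red_def restrict_to_def)
    from step(2) consider "red_l N N'" | "red_l N' N" | "red_beta_v N N'"
      by (auto simp: lin_eq_red_def restrict_to_def symclp_def)
    then have "(alg_eq_red S\<^sub>a)\<^sup>*\<^sup>* (?c N) (?c N')"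
    proof cases
      case 1
      then show ?thesis
        using alg_fragment_rtranclp[OF assms(2) in_S(1)] red_l_colon
          rtranclp_red_a_imp_red_a_beta by blast
    next
      \<comment> \<open>The path runs forwards from \<open>?c N'\<close>, which is already known to
        lie in the fragment, and is traversed backwards.\<close>
      case 2
      then show ?thesis
        using alg_fragment_rtranclp_rev[OF assms(2) in_S(2)] red_l_colon by blast
    next
      case 3
      then show ?thesis
        using alg_fragment_rtranclp[OF assms(2) in_S(1)] red_beta_v_colon[OF _ id] by blast
    qed
    with step(3) show ?case by auto
  qed
  then show ?thesis by (simp add: colon_value assms(5))
qed

end
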